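(* Let $T=(V,E)$ be a directed tree, let $\lambda=\{\lambda_v\}_{v\in V}$ be a sequence of positive numbers, let $1<p<\infty$, and let $q:=\frac{p}{p-1}$. Assume the shift operator $S:\mathbf{L}^p(T,\lambda)\to\mathbf{L}^p(T,\lambda)$ is bounded. Then its adjoint $S^*:\mathbf{L}^q(T,\lambda)\to\mathbf{L}^q(T,\lambda)$ is given by $$(S^*g)(u)=\sum_{v\in\operatorname{Chi}(u)}g(v)\frac{\lambda_v}{\lambda_u}$$ for each $g\in\mathbf{L}^q(T,\lambda)$ and $u\in V$.
   Context: A directed graph $T=(V,E)$ consists of a countably infinite set $V$ of vertices and a set $E\subseteq V\times V$ of directed edges; it is always assumed locally finite (every vertex has finite indegree and finite outdegree). $T$ is a directed tree if it has no directed circuits (including loops $(v,v)$), its underlying undirected graph is connected, and every vertex has indegree $0$ or $1$. A root is a vertex of indegree $0$ (there is at most one, denoted $\mathrm{root}$; it need not exist). For $v\ne\mathrm{root}$, the parent $\operatorname{par}(v)$ is the unique $u$ with $(u,v)\in E$; $\operatorname{Chi}(u)=\{v\in V:\operatorname{par}(v)=u\}$. Sums over empty sets are $0$. For $1\le r<\infty$, $\mathbf{L}^r(T,\lambda)$ is the complex Banach space of functions $f:V\to\mathbb{C}$ with $\|f\|_r=\big(\sum_{v\in V}|f(v)|^r\lambda_v\big)^{1/r}<\infty$. The shift $S$ is defined by $(Sf)(v)=f(\operatorname{par}(v))$ if $v\neq\mathrm{root}$ and $(Sf)(\mathrm{root})=0$ (if there is a root). The dual space of $\mathbf{L}^p(T,\lambda)$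 is identified with $\mathbf{L}^q(T,\lambda)$ by identifying $g\in\mathbf{L}^q(T,\lambda)$ with the functional $\Phi_g(f)=\sum_{v\in V}f(v)g(v)\lambda_v$ (no complex conjugation). $S^*$ is the Banach space adjoint under this identification: $\Phi_{S^*g}(f)=\Phi_g(Sf)$. *)

theory Defs
  imports "HOL-Analysis.Analysis"
begin

definition directed_graph :: "'v set \<Rightarrow> ('v \<times> 'v) set \<Rightarrow> bool" where
  "directed_graph V E \<longleftrightarrow>
     countable V \<and> infinite V \<and> E \<subseteq> V \<times> V \<and>
     (\<forall>v\<in>V. finite {u. (u, v) \<in> E} \<and> finite {u. (v, u) \<in> E})"

definition indegree :: "('v \<times> 'v) set \<Rightarrow> 'v \<Rightarrow> nat" where
  "indegree E v = card {u. (u, v) \<in> E}"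

definition directed_tree :: "'v set \<Rightarrow> ('v \<times> 'v) set \<Rightarrow> bool" where
  "directed_tree V E \<longleftrightarrow>
     directed_graph V E \<and> acyclic E \<and>
     (\<forall>u\<in>V. \<forall>v\<in>V. (u, v) \<in> (E \<union> E\<inverse>)\<^sup>*) \<and>
     (\<forall>v\<in>V. indegree E v = 0 \<or> indegree E v = 1)"

definition is_root :: "'v set \<Rightarrow> ('v \<times> 'v) set \<Rightarrow> 'v \<Rightarrow> bool" where
  "is_root V E v \<longleftrightarrow> v \<in> V \<and> indegree E v = 0"

text \<open>Only meaningful for a vertex that is not a root.\<close>

definition par :: "('v \<times> 'v) set \<Rightarrow> 'v \<Rightarrow> 'v" where
  "par E v = (THE u. (u, v) \<in> E)"

definition Chi :: "'v set \<Rightarrow> ('v \<times> 'v) set \<Rightarrow> 'v \<Rightarrow> 'v set" where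
  "Chi V E u = {v \<in> V. \<not> is_root V E v \<and> par E v = u}"

text \<open>A function from \<open>V\<close> to the complex numbers is represented by its extension by zero to
  the whole type, so that equality of representatives is equality on \<open>V\<close>.\<close>

definition L_space :: "'v set \<Rightarrow> ('v \<Rightarrow> real) \<Rightarrow> real \<Rightarrow> ('v \<Rightarrow> complex) set" where
  "L_space V w r =
     {f. (\<forall>v. v \<notin> V \<longrightarrow> f v = 0) \<and> (\<lambda>v. cmod (f v) powr r * w v) summable_on V}"

definition L_norm :: "'v set \<Rightarrow> ('v \<Rightarrow> real) \<Rightarrow> real \<Rightarrow> ('v \<Rightarrow> complex) \<Rightarrow> real" where
  "L_norm V w r f = (\<Sum>\<^sub>\<infinity>v\<in>V. cmod (f v) powr r * w v) powr (1 / r)"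

definition shift_op :: "'v set \<Rightarrow> ('v \<times> 'v) set \<Rightarrow> ('v \<Rightarrow> complex) \<Rightarrow> 'v \<Rightarrow> complex" where
  "shift_op V E f v = (if v \<in> V \<and> \<not> is_root V E v then f (par E v) else 0)"

text \<open>Boundedness of an operator that is already known to be linear, as the shift is. It includes
  that the operator maps the space into itself.\<close>

definition L_bounded ::
  "'v set \<Rightarrow> ('v \<Rightarrow> real) \<Rightarrow> real \<Rightarrow> (('v \<Rightarrow> complex) \<Rightarrow> 'v \<Rightarrow> complex) \<Rightarrow> bool" where
  "L_bounded V w r A \<longleftrightarrow>
     (\<forall>f\<in>L_space V w r. A f \<in> L_space V w r) \<and>
     (\<exists>C. \<forall>f\<in>L_space V w r. L_norm V w r (A f) \<le> C * L_norm V w r f)"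

definition dual_pairing ::
  "'v set \<Rightarrow> ('v \<Rightarrow> real) \<Rightarrow> ('v \<Rightarrow> complex) \<Rightarrow> ('v \<Rightarrow> complex) \<Rightarrow> complex" where
  "dual_pairing V w g f = (\<Sum>\<^sub>\<infinity>v\<in>V. f v * g v * complex_of_real (w v))"

text \<open>The Banach space adjoint of an operator on the space with exponent \<open>p\<close>, carried over to the
  space with the conjugate exponent \<open>q\<close>: the functional of \<open>g\<close> composed with \<open>A\<close> is again
  the functional of exactly one element of that space, which is the value at \<open>g\<close>.\<close>

definition L_adjoint ::
  "'v set \<Rightarrow> ('v \<Rightarrow> real) \<Rightarrow> real \<Rightarrow> real \<Rightarrow> (('v \<Rightarrow> complex) \<Rightarrow> 'v \<Rightarrow> complex) \<Rightarrow>
   ('v \<Rightarrow> complex) \<Rightarrow> 'v \<Rightarrow> complex" where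
  "L_adjoint V w p q A g =
     (THE h. h \<in> L_space V w q \<and>
        (\<forall>f\<in>L_space V w p. dual_pairing V w h f = dual_pairing V w g (A f)))"

end

theory Submission
  imports Defs
begin

(* Let h denote the right-hand side of the formula.  Testing boundedness of the shift on the point
   mass at u gives w(Chi u) <= K w(u) with K independent of u; by Jensen's inequality this yields
   |h u|^q w u <= K^(q-1) * (sum over v in Chi u of |g v|^q w v).  The sets Chi u partition the
   non-root vertices, so h lies in L^q directly, without L^p-L^q duality.  Regrouping the pairing
   of g with the shift of f along the same partition shows that h represents the adjoint
   functional, and point masses separate representatives. *)

text \<open>Jensen's inequality for \<open>t powr q\<close> with the probability weights
  \<open>w i / W\<close>, multiplied out by the total weight \<open>W\<close>. The total weight is
  kept as an explicit factor so that a bound on the weight of a child set can be inserted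
  later.\<close>

lemma sum_weighted_powr_le:
  fixes x w :: "'a \<Rightarrow> real"
  assumes "finite S" and q: "1 \<le> q"
    and w: "\<And>i. i \<in> S \<Longrightarrow> 0 < w i" and x: "\<And>i. i \<in> S \<Longrightarrow> 0 \<le> x i"
  shows "(\<Sum>i\<in>S. x i * w i) powr q \<le> (\<Sum>i\<in>S. w i) powr (q - 1) * (\<Sum>i\<in>S. x i powr q * w i)"
proof -
  \<comment> \<open>\<open>powr_convex\<close> covers only the open half-line, so vanishing terms are dropped first.\<close>
  define P where "P = {i\<in>S. 0 < x i}"
  have P: "finite P" "P \<subseteq> S" "\<And>i. i \<in> P \<Longrightarrow> 0 < w i" "\<And>i. i \<in> P \<Longrightarrow> 0 < x i"
    using assms by (auto simp: P_def)
  have zero: "x i = 0" if "i \<in> S - P" for i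
    using x[of i] that by (auto simp: P_def)
  have eq1: "(\<Sum>i\<in>S. x i * w i) = (\<Sum>i\<in>P. x i * w i)"
    using zero \<open>finite S\<close> P(2) by (intro sum.mono_neutral_right) auto
  have eq2: "(\<Sum>i\<in>S. x i powr q * w i) = (\<Sum>i\<in>P. x i powr q * w i)"
    using zero \<open>finite S\<close> P(2) by (intro sum.mono_neutral_right) auto
  show ?thesis
  proof (cases "P = {}")
    case True
    then show ?thesis by (simp add: eq1 eq2)
  next
    case False
    define W where "W = (\<Sum>i\<in>P. w i)"
    have W: "0 < W"
      unfolding W_def using False P by (intro sum_pos) auto
    \<comment> \<open>Dropping terms may shrink the total weight; since \<open>q - 1\<close> is
      nonnegative, the full total can be put back at the end.\<close>
    have WS: "W \<le> (\<Sum>i\<in>S. w i)"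
      unfolding W_def using P(2) \<open>finite S\<close> w by (intro sum_mono2) (auto intro: less_imp_le)
    have "(\<Sum>i\<in>P. (w i / W) *\<^sub>R x i) powr q \<le> (\<Sum>i\<in>P. (w i / W) * x i powr q)"
    proof (rule convex_on_sum[OF P(1) False powr_convex[OF q]])
      show "(\<Sum>i\<in>P. w i / W) = 1"
        using W by (simp add: W_def flip: sum_divide_distrib)
      show "0 \<le> w i / W" if "i \<in> P" for i
        using P(3)[OF that] W by simp
      show "x i \<in> {0<..}" if "i \<in> P" for i
        using P(4)[OF that] by simp
    qed
    then have "((\<Sum>i\<in>P. x i * w i) / W) powr q \<le> (\<Sum>i\<in>P. x i powr q * w i) / W"
      by (simp add: sum_divide_distrib mult.commute)
    moreover have "0 \<le> (\<Sum>i\<in>P. x i * w i)"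
      using P by (intro sum_nonneg) (simp add: less_imp_le)
    ultimately have "(\<Sum>i\<in>P. x i * w i) powr q \<le> W powr q / W * (\<Sum>i\<in>P. x i powr q * w i)"
      using W by (simp add: powr_divide field_simps)
    also have "\<dots> = W powr (q - 1) * (\<Sum>i\<in>P. x i powr q * w i)"
      using W by (simp add: powr_diff)
    also have "\<dots> \<le> (\<Sum>i\<in>S. w i) powr (q - 1) * (\<Sum>i\<in>P. x i powr q * w i)"
      using W WS q P by (intro mult_right_mono powr_mono2 sum_nonneg) (auto simp: less_imp_le)
    finally show ?thesis by (simp add: eq1 eq2)
  qed
qed

text \<open>A vertex that is not a root has indegree 1, so exactly one edge enters it and the
  \<open>THE\<close> in \<open>par\<close> is well defined.\<close>

lemma directed_tree_parent:
  assumes "directed_tree V E" "v \<in> V" "\<not> is_root V E v"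
  shows "(par E v, v) \<in> E"
proof -
  have "card {u. (u, v) \<in> E} = 1"
    using assms by (auto simp: directed_tree_def is_root_def indegree_def)
  then obtain u where "{u. (u, v) \<in> E} = {u}"
    by (auto simp: card_1_singleton_iff)
  then have "\<And>x. (x, v) \<in> E \<longleftrightarrow> x = u" by (metis mem_Collect_eq singleton_iff)
  then have "\<exists>!u. (u, v) \<in> E" by auto
  then show ?thesis unfolding par_def by (rule theI')
qed

lemma directed_tree_par_in:
  assumes "directed_tree V E" "v \<in> V" "\<not> is_root V E v"
  shows "par E v \<in> V"
  using directed_tree_parent[OF assms] assms(1) by (auto simp: directed_tree_def directed_graph_def)

lemma finite_Chi:
  assumes "directed_tree V E" "u \<in> V"
  shows "finite (Chi V E u)"
proof (rule finite_subset)
  show "Chi V E u \<subseteq> {v. (u, v) \<in> E}"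
    using directed_tree_parent[OF assms(1)] by (auto simp: Chi_def)
  show "finite {v. (u, v) \<in> E}"
    using assms by (auto simp: directed_tree_def directed_graph_def)
qed

text \<open>The child sets partition the non-root vertices: \<open>v\<close> occurs only in the
  child set of its parent, which gives the inverse map.\<close>

lemma bij_betw_snd_Sigma_Chi:
  assumes "directed_tree V E"
  shows "bij_betw snd (Sigma V (Chi V E)) {v \<in> V. \<not> is_root V E v}"
  by (rule bij_betw_byWitness[where f' = "\<lambda>v. (par E v, v)"])
     (use directed_tree_par_in[OF assms] in \<open>auto simp: Chi_def\<close>)

text \<open>Fubini along this partition, with finite inner sums by local finiteness. Banach-space
  values cover both the real series of \<open>q\<close>-th powers and the complex series of the
  pairing.\<close>

lemma summable_on_sum_Chi:
  fixes F :: "'v \<Rightarrow> 'b::banach"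
  assumes T: "directed_tree V E" and F: "F summable_on {v \<in> V. \<not> is_root V E v}"
  shows "(\<lambda>u. \<Sum>v\<in>Chi V E u. F v) summable_on V"
    and "(\<Sum>\<^sub>\<infinity>u\<in>V. \<Sum>v\<in>Chi V E u. F v) = (\<Sum>\<^sub>\<infinity>v\<in>{v \<in> V. \<not> is_root V E v}. F v)"
proof -
  have s: "(\<lambda>(u, v). F v) summable_on Sigma V (Chi V E)"
    using F summable_on_reindex_bij_betw[OF bij_betw_snd_Sigma_Chi[OF T], of F]
    by (simp add: case_prod_unfold)
  have c: "infsum F (Chi V E u) = (\<Sum>v\<in>Chi V E u. F v)" if "u \<in> V" for u
    using finite_Chi[OF T that] by simp
  show "(\<lambda>u. \<Sum>v\<in>Chi V E u. F v) summable_on V"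
    using summable_on_Sigma_banach[OF s] c by (simp cong: summable_on_cong)
  have "(\<Sum>\<^sub>\<infinity>u\<in>V. \<Sum>v\<in>Chi V E u. F v) = (\<Sum>\<^sub>\<infinity>u\<in>V. infsum F (Chi V E u))"
    using c by (intro infsum_cong) simp
  also have "\<dots> = infsum (\<lambda>(u, v). F v) (Sigma V (Chi V E))"
    by (rule infsum_Sigma'_banach[OF s])
  also have "\<dots> = infsum F {v \<in> V. \<not> is_root V E v}"
    using infsum_reindex_bij_betw[OF bij_betw_snd_Sigma_Chi[OF T], of F]
    by (simp add: case_prod_unfold)
  finally show "(\<Sum>\<^sub>\<infinity>u\<in>V. \<Sum>v\<in>Chi V E u. F v) = (\<Sum>\<^sub>\<infinity>v\<in>{v \<in> V. \<not> is_root V E v}. F v)" .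
qed

text \<open>Young's inequality dominates each term by a combination of the two convergent series.
  Summability is what justifies regrouping the pairing.\<close>

lemma dual_pairing_summable:
  assumes w: "\<forall>v\<in>V. 0 < w v" and p: "1 < p" and q: "q = p / (p - 1)"
    and f: "f \<in> L_space V w p" and g: "g \<in> L_space V w q"
  shows "(\<lambda>v. f v * g v * complex_of_real (w v)) summable_on V"
proof (rule abs_summable_summable)
  have q1: "1 < q" and pq: "1 / p + 1 / q = 1"
    unfolding q using p by (auto simp: field_simps)
  have "(\<lambda>v. cmod (f v) powr p * w v * (1 / p) + cmod (g v) powr q * w v * (1 / q)) summable_on V"
    using f g by (intro summable_on_add summable_on_cmult_left) (auto simp: L_space_def)
  then show "(\<lambda>v. cmod (f v * g v * complex_of_real (w v))) summable_on V"
  proof (rule Infinite_Sum.abs_summable_on_comparison_test')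
    fix v assume "v \<in> V"
    then have wv: "0 < w v" using w by simp
    have "cmod (f v) * cmod (g v) \<le> cmod (f v) powr p / p + cmod (g v) powr q / q"
      using p q1 pq by (intro Youngs_inequality) auto
    then have "cmod (f v) * cmod (g v) * w v \<le> (cmod (f v) powr p / p + cmod (g v) powr q / q) * w v"
      using wv by (intro mult_right_mono) auto
    then show "cmod (f v * g v * complex_of_real (w v))
        \<le> cmod (f v) powr p * w v * (1 / p) + cmod (g v) powr q * w v * (1 / q)"
      using wv by (simp add: norm_mult algebra_simps)
  qed
qed

abbreviation point_mass :: "'v \<Rightarrow> 'v \<Rightarrow> complex" where
  "point_mass u \<equiv> \<lambda>v. if v = u then 1 else 0"

lemma point_mass_in_L_space:
  assumes "u \<in> V"
  shows "point_mass u \<in> L_space V w p"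
proof -
  have "(\<lambda>v. cmod (point_mass u v) powr p * w v) summable_on V
      \<longleftrightarrow> (\<lambda>v. cmod (point_mass u v) powr p * w v) summable_on {u}"
    by (rule summable_on_cong_neutral) (use assms in auto)
  then show ?thesis using assms by (auto simp: L_space_def)
qed

text \<open>Evaluates the norm of a point mass and of its shift, both of which are indicators of
  finite sets.\<close>

lemma L_norm_indicator:
  assumes "finite S" "S \<subseteq> V" "\<And>v. v \<in> S \<Longrightarrow> f v = 1" "\<And>v. v \<in> V - S \<Longrightarrow> f v = 0"
  shows "L_norm V w p f = (\<Sum>v\<in>S. w v) powr (1 / p)"
proof -
  have "(\<Sum>\<^sub>\<infinity>v\<in>V. cmod (f v) powr p * w v) = (\<Sum>\<^sub>\<infinity>v\<in>S. w v)"
    by (rule infsum_cong_neutral) (use assms in auto)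
  then show ?thesis using assms(1) by (simp add: L_norm_def)
qed

lemma dual_pairing_point_mass:
  assumes "u \<in> V"
  shows "dual_pairing V w h (point_mass u) = h u * complex_of_real (w u)"
proof -
  have "dual_pairing V w h (point_mass u) = (\<Sum>\<^sub>\<infinity>v\<in>{u}. h v * complex_of_real (w v))"
    unfolding dual_pairing_def by (rule infsum_cong_neutral) (use assms in auto)
  then show ?thesis by simp
qed

lemma shift_op_bounded_imp_weight_Chi_bounded:
  assumes T: "directed_tree V E" and w: "\<forall>v\<in>V. 0 < w v" and p: "1 < p"
    and B: "L_bounded V w p (shift_op V E)"
  obtains K where "\<And>u. u \<in> V \<Longrightarrow> (\<Sum>v\<in>Chi V E u. w v) \<le> K * w u"
proof -
  obtain C where C: "\<And>f. f \<in> L_space V w p \<Longrightarrow> L_norm V w p (shift_op V E f) \<le> C * L_norm V w p f"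
    using B by (auto simp: L_bounded_def)
  show ?thesis
  proof
    fix u assume u: "u \<in> V"
    \<comment> \<open>The shift of the point mass at \<open>u\<close> is the indicator of
      \<open>Chi V E u\<close>.\<close>
    have "L_norm V w p (shift_op V E (point_mass u)) = (\<Sum>v\<in>Chi V E u. w v) powr (1 / p)"
      using finite_Chi[OF T u] by (intro L_norm_indicator) (auto simp: Chi_def shift_op_def)
    moreover have "L_norm V w p (point_mass u) = w u powr (1 / p)"
      using u L_norm_indicator[of "{u}" V "point_mass u" w p] by simp
    ultimately have "(\<Sum>v\<in>Chi V E u. w v) powr (1 / p) \<le> C * w u powr (1 / p)"
      using C[OF point_mass_in_L_space[OF u]] by simp
    \<comment> \<open>Boundedness gives no sign for \<open>C\<close>; its absolute value lets the
      \<open>p\<close>-th power split over the product.\<close>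
    also have "\<dots> \<le> \<bar>C\<bar> * w u powr (1 / p)"
      by (intro mult_right_mono) auto
    finally have "((\<Sum>v\<in>Chi V E u. w v) powr (1 / p)) powr p \<le> (\<bar>C\<bar> * w u powr (1 / p)) powr p"
      using p by (intro powr_mono2) auto
    moreover have "0 \<le> (\<Sum>v\<in>Chi V E u. w v)" "0 \<le> w u"
      using w u by (auto intro!: sum_nonneg simp: Chi_def less_imp_le)
    ultimately show "(\<Sum>v\<in>Chi V E u. w v) \<le> \<bar>C\<bar> powr p * w u"
      using p by (simp add: powr_mult powr_powr)
  qed
qed

text \<open>The value 0 off \<open>V\<close> matches the convention of \<open>L_space\<close>, so
  that equality with the adjoint holds on the whole type.\<close>

definition shift_adj ::
  "'v set \<Rightarrow> ('v \<times> 'v) set \<Rightarrow> ('v \<Rightarrow> real) \<Rightarrow> ('v \<Rightarrow> complex) \<Rightarrow> 'v \<Rightarrow> complex" where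
  "shift_adj V E w g u =
     (if u \<in> V then \<Sum>v\<in>Chi V E u. g v * complex_of_real (w v / w u) else 0)"

lemma shift_adj_in_L_space:
  assumes T: "directed_tree V E" and w: "\<forall>v\<in>V. 0 < w v" and q: "1 < q"
    and K: "\<And>u. u \<in> V \<Longrightarrow> (\<Sum>v\<in>Chi V E u. w v) \<le> K * w u"
    and g: "g \<in> L_space V w q"
  shows "shift_adj V E w g \<in> L_space V w q"
proof -
  have bound: "cmod (shift_adj V E w g u) powr q * w u
      \<le> (\<Sum>v\<in>Chi V E u. cmod (g v) powr q * w v) * K powr (q - 1)" if u: "u \<in> V" for u
  proof -
    let ?A = "\<Sum>v\<in>Chi V E u. cmod (g v) * w v"
    let ?B = "\<Sum>v\<in>Chi V E u. cmod (g v) powr q * w v"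
    have wu: "0 < w u" using u w by simp
    have wC: "0 < w v" if "v \<in> Chi V E u" for v using that w by (simp add: Chi_def)
    have S: "0 \<le> (\<Sum>v\<in>Chi V E u. w v)"
      using wC by (intro sum_nonneg) (auto intro: less_imp_le)
    have "0 \<le> K * w u" using S K[OF u] by linarith
    then have K0: "0 \<le> K" using wu by (simp add: zero_le_mult_iff)
    have A: "0 \<le> ?A" and B: "0 \<le> ?B"
      using wC by (auto intro!: sum_nonneg mult_nonneg_nonneg dest: less_imp_le)
    have "cmod (shift_adj V E w g u) \<le> (\<Sum>v\<in>Chi V E u. cmod (g v * complex_of_real (w v / w u)))"
      using u by (simp add: shift_adj_def norm_sum)
    also have "\<dots> = ?A / w u"
      using wC wu unfolding sum_divide_distrib
      by (intro sum.cong) (auto simp: norm_mult norm_divide less_imp_le abs_of_pos)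
    finally have "cmod (shift_adj V E w g u) powr q \<le> (?A / w u) powr q"
      using q by (intro powr_mono2) auto
    also have "\<dots> = ?A powr q / w u powr q"
      using A wu by (simp add: powr_divide)
    \<comment> \<open>Jensen on the child set; the bound by \<open>K * w u\<close> then leaves a
      single factor \<open>1 / w u\<close>, which the weight at \<open>u\<close> cancels.\<close>
    also have "\<dots> \<le> (\<Sum>v\<in>Chi V E u. w v) powr (q - 1) * ?B / w u powr q"
      using sum_weighted_powr_le[OF finite_Chi[OF T u], of q w "\<lambda>v. cmod (g v)"] q wC
      by (intro divide_right_mono) auto
    also have "\<dots> \<le> (K * w u) powr (q - 1) * ?B / w u powr q"
      using S K[OF u] q B by (intro divide_right_mono mult_right_mono powr_mono2) auto
    also have "\<dots> = K powr (q - 1) * ?B / w u"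
      using K0 wu by (simp add: powr_mult powr_diff)
    finally show ?thesis
      using wu by (simp add: field_simps)
  qed
  have "(\<lambda>v. cmod (g v) powr q * w v) summable_on {v \<in> V. \<not> is_root V E v}"
    using g by (auto simp: L_space_def intro: summable_on_subset_banach)
  from summable_on_sum_Chi(1)[OF T this]
  have "(\<lambda>u. (\<Sum>v\<in>Chi V E u. cmod (g v) powr q * w v) * K powr (q - 1)) summable_on V"
    by (rule summable_on_cmult_left)
  then have "(\<lambda>u. cmod (shift_adj V E w g u) powr q * w u) summable_on V"
    by (rule summable_on_comparison_test) (use bound w in \<open>auto simp: less_imp_le\<close>)
  then show ?thesis by (simp add: L_space_def shift_adj_def)
qed

text \<open>On the children of \<open>u\<close> the shift of \<open>f\<close> is constantly
  \<open>f u\<close>, and the weight at \<open>u\<close> cancels the denominator in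
  \<open>shift_adj\<close>. A root adds nothing, because the shift vanishes there.\<close>

lemma dual_pairing_shift_adj:
  assumes T: "directed_tree V E" and w: "\<forall>v\<in>V. 0 < w v"
    and s: "(\<lambda>v. shift_op V E f v * g v * complex_of_real (w v)) summable_on V"
  shows "dual_pairing V w (shift_adj V E w g) f = dual_pairing V w g (shift_op V E f)"
proof -
  let ?F = "\<lambda>v. shift_op V E f v * g v * complex_of_real (w v)"
  have s': "?F summable_on {v \<in> V. \<not> is_root V E v}"
    using s by (rule summable_on_subset_banach) auto
  have "f u * shift_adj V E w g u * complex_of_real (w u) = (\<Sum>v\<in>Chi V E u. ?F v)" if "u \<in> V" for u
  proof -
    have "w u \<noteq> 0" using w that by force
    then show ?thesis
      using that by (auto simp: shift_adj_def sum_distrib_left sum_distrib_right Chi_def shift_op_def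
          intro!: sum.cong)
  qed
  then have "dual_pairing V w (shift_adj V E w g) f = (\<Sum>\<^sub>\<infinity>u\<in>V. \<Sum>v\<in>Chi V E u. ?F v)"
    unfolding dual_pairing_def by (intro infsum_cong)
  also have "\<dots> = (\<Sum>\<^sub>\<infinity>v\<in>{v \<in> V. \<not> is_root V E v}. ?F v)"
    by (rule summable_on_sum_Chi(2)[OF T s'])
  also have "\<dots> = dual_pairing V w g (shift_op V E f)"
    unfolding dual_pairing_def by (rule infsum_cong_neutral) (auto simp: shift_op_def)
  finally show ?thesis .
qed

text \<open>Uniqueness for the \<open>THE\<close>: pairing with the point mass at \<open>u\<close>
  yields the value at \<open>u\<close> times the nonzero \<open>w u\<close>, and off
  \<open>V\<close> all representatives are 0.\<close>

lemma L_adjoint_eqI: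
  assumes w: "\<forall>v\<in>V. 0 < w v" and h: "h \<in> L_space V w q"
    and rep: "\<And>f. f \<in> L_space V w p \<Longrightarrow> dual_pairing V w h f = dual_pairing V w g (A f)"
  shows "L_adjoint V w p q A g = h"
  unfolding L_adjoint_def
proof (rule the_equality)
  show "h \<in> L_space V w q \<and> (\<forall>f\<in>L_space V w p. dual_pairing V w h f = dual_pairing V w g (A f))"
    using h rep by blast
next
  fix k assume k: "k \<in> L_space V w q \<and>
    (\<forall>f\<in>L_space V w p. dual_pairing V w k f = dual_pairing V w g (A f))"
  show "k = h"
  proof
    fix u
    show "k u = h u"
    proof (cases "u \<in> V")
      case True
      have "dual_pairing V w k (point_mass u) = dual_pairing V w h (point_mass u)"
        using k rep point_mass_in_L_space[OF True, of w p] by simp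
      moreover have "w u \<noteq> 0" using w True by force
      ultimately show ?thesis by (simp add: dual_pairing_point_mass[OF True])
    next
      case False
      then show ?thesis using k h by (simp add: L_space_def)
    qed
  qed
qed

theorem proposition4p2:
  fixes V :: "'v set" and E :: "('v \<times> 'v) set"
    and w :: "'v \<Rightarrow> real" and p q :: real
  assumes "directed_tree V E"
    and "\<forall>v\<in>V. 0 < w v"
    and "1 < p"
    and "q = p / (p - 1)"
    and "L_bounded V w p (shift_op V E)"
  shows "\<forall>g\<in>L_space V w q.
           L_adjoint V w p q (shift_op V E) g \<in> L_space V w q \<and>
           (\<forall>u\<in>V. L_adjoint V w p q (shift_op V E) g u =
              (\<Sum>v\<in>Chi V E u. g v * complex_of_real (w v / w u)))"
proof
  fix g assume g: "g \<in> L_space V w q"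
  have q: "1 < q" unfolding assms(4) using assms(3) by (simp add: field_simps)
  obtain K where K: "\<And>u. u \<in> V \<Longrightarrow> (\<Sum>v\<in>Chi V E u. w v) \<le> K * w u"
    using shift_op_bounded_imp_weight_Chi_bounded[OF assms(1-3,5)] by blast
  have h: "shift_adj V E w g \<in> L_space V w q"
    by (rule shift_adj_in_L_space[OF assms(1,2) q K g])
  have "L_adjoint V w p q (shift_op V E) g = shift_adj V E w g"
  proof (rule L_adjoint_eqI[OF assms(2) h])
    fix f assume "f \<in> L_space V w p"
    \<comment> \<open>Invariance of the space under the shift makes the pairing of \<open>g\<close>
      with the shifted function summable.\<close>
    then have "shift_op V E f \<in> L_space V w p"
      using assms(5) by (simp add: L_bounded_def)
    then show "dual_pairing V w (shift_adj V E w g) f = dual_pairing V w g (shift_op V E f)"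
      by (intro dual_pairing_shift_adj dual_pairing_summable[OF assms(2-4) _ g] assms(1,2))
  qed
  then show "L_adjoint V w p q (shift_op V E) g \<in> L_space V w q \<and>
      (\<forall>u\<in>V. L_adjoint V w p q (shift_op V E) g u =
        (\<Sum>v\<in>Chi V E u. g v * complex_of_real (w v / w u)))"
    using h by (simp add: shift_adj_def)
qed

end
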